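(* Let $M$ and $P$ be disjoint finite sets and let $c\notin M\cup P$. Let $(f,M\cup\{c\})$ and $(g,P)$ be polymatroids with $f(\{c\})=g(P)$. Then there is a polymatroid $(r,M\cup P)$ such that for all $A\subseteq M$ and $B\subseteq P$ $$r(A)=f(A),\qquad r(B)=g(B),\qquad r(A\cup P)=f(A\cup\{c\}).$$
   Context: A polymatroid $(f,N)$ on a finite ground set $N$ is a non-negative, monotone, submodular real function $f$ on the subsets of $N$ with $f(\emptyset)=0$. *)

theory Defs
  imports Complex_Main
begin

(* The values of f on sets that are not subsets of N are irrelevant. *)
definition polymatroid :: "('a set \<Rightarrow> real) \<Rightarrow> 'a set \<Rightarrow> bool" where
  "polymatroid f N \<longleftrightarrow>
     finite N \<and>
     f {} = 0 \<and>
     (\<forall>A. A \<subseteq> N \<longrightarrow> 0 \<le> f A) \<and>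
     (\<forall>A B. A \<subseteq> B \<and> B \<subseteq> N \<longrightarrow> f A \<le> f B) \<and>
     (\<forall>A B. A \<subseteq> N \<and> B \<subseteq> N \<longrightarrow> f (A \<union> B) + f (A \<inter> B) \<le> f A + f B)"

end

theory Submission
  imports Defs
begin

text \<open>
  The amalgam is \<open>r (A \<union> B) = min (f A + g B) (f (A \<union> {c}))\<close> for \<open>A \<subseteq> M\<close> and \<open>B \<subseteq> P\<close>.
  For submodularity, the only case that does not reduce to submodularity of \<open>f\<close> and \<open>g\<close>
  separately is the one where the two minima are attained on different sides; there
  \<open>f A + f (A' \<union> {c}) \<ge> f (A \<union> A' \<union> {c}) + f (A \<inter> A')\<close> because \<open>c \<notin> A\<close>, and
  \<open>g B \<ge> g (B \<inter> B')\<close>.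
\<close>

lemma polymatroid_empty: "polymatroid f N \<Longrightarrow> f {} = 0"
  by (simp add: polymatroid_def)

lemma polymatroid_nonneg: "polymatroid f N \<Longrightarrow> A \<subseteq> N \<Longrightarrow> 0 \<le> f A"
  by (simp add: polymatroid_def)

lemma polymatroid_mono: "polymatroid f N \<Longrightarrow> A \<subseteq> B \<Longrightarrow> B \<subseteq> N \<Longrightarrow> f A \<le> f B"
  by (simp add: polymatroid_def)

lemma polymatroid_submodular:
  "polymatroid f N \<Longrightarrow> A \<subseteq> N \<Longrightarrow> B \<subseteq> N \<Longrightarrow> f (A \<union> B) + f (A \<inter> B) \<le> f A + f B"
  by (simp add: polymatroid_def)

text \<open>Working with the traces on \<open>M\<close> and \<open>P\<close> makes this a function
  of a single set. When \<open>M\<close> and \<open>P\<close> are disjoint, the traces recover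
  \<open>A\<close> and \<open>B\<close> from \<open>A \<union> B\<close>. The second argument of the
  minimum acts as a cap: it is the value reached when all of \<open>c\<close> is added to
  \<open>A\<close>.\<close>

definition amalgam ::
    "('a set \<Rightarrow> real) \<Rightarrow> ('a set \<Rightarrow> real) \<Rightarrow> 'a set \<Rightarrow> 'a set \<Rightarrow> 'a \<Rightarrow> 'a set \<Rightarrow> real" where
  "amalgam f g M P c X = min (f (X \<inter> M) + g (X \<inter> P)) (f (X \<inter> M \<union> {c}))"

lemma polymatroid_amalgam:
  assumes M: "finite M" and P: "finite P" and c: "c \<notin> M"
    and f: "polymatroid f (M \<union> {c})" and g: "polymatroid g P"
  shows "polymatroid (amalgam f g M P c) (M \<union> P)"
  unfolding polymatroid_def
proof (intro conjI allI impI)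
  show "finite (M \<union> P)"
    using M P by simp
  \<comment> \<open>Here the sum is 0 and the cap is \<open>f {c}\<close>, so non-negativity of
    \<open>f {c}\<close> decides the minimum.\<close>
  show "amalgam f g M P c {} = 0"
    using polymatroid_empty[OF f] polymatroid_empty[OF g] polymatroid_nonneg[OF f, of "{c}"]
    by (simp add: amalgam_def)
next
  fix X
  have "0 \<le> f (X \<inter> M)" "0 \<le> f (X \<inter> M \<union> {c})"
    by (rule polymatroid_nonneg[OF f], blast)+
  moreover have "0 \<le> g (X \<inter> P)"
    by (rule polymatroid_nonneg[OF g]) blast
  ultimately show "0 \<le> amalgam f g M P c X"
    by (simp add: amalgam_def)
next
  fix X Y assume "X \<subseteq> Y \<and> Y \<subseteq> M \<union> P"
  then have "X \<subseteq> Y" by simp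
  have "f (X \<inter> M) \<le> f (Y \<inter> M)" "f (X \<inter> M \<union> {c}) \<le> f (Y \<inter> M \<union> {c})"
    by (rule polymatroid_mono[OF f], use \<open>X \<subseteq> Y\<close> in blast, blast)+
  moreover have "g (X \<inter> P) \<le> g (Y \<inter> P)"
    by (rule polymatroid_mono[OF g]) (use \<open>X \<subseteq> Y\<close> in blast)+
  ultimately show "amalgam f g M P c X \<le> amalgam f g M P c Y"
    by (simp add: amalgam_def min_def)
next
  fix X Y
  define A B where "A = X \<inter> M" and "B = X \<inter> P"
  define A' B' where "A' = Y \<inter> M" and "B' = Y \<inter> P"
  have AM: "A \<subseteq> M" "A' \<subseteq> M" and BP: "B \<subseteq> P" "B' \<subseteq> P"
    by (auto simp: A_def A'_def B_def B'_def)
  have un: "(X \<union> Y) \<inter> M = A \<union> A'" "(X \<union> Y) \<inter> P = B \<union> B'"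
    and int: "(X \<inter> Y) \<inter> M = A \<inter> A'" "(X \<inter> Y) \<inter> P = B \<inter> B'"
    by (auto simp: A_def A'_def B_def B'_def)
  have sub_f: "f (A \<union> A') + f (A \<inter> A') \<le> f A + f A'"
    by (rule polymatroid_submodular[OF f]) (use AM in auto)
  have sub_g: "g (B \<union> B') + g (B \<inter> B') \<le> g B + g B'"
    by (rule polymatroid_submodular[OF g BP])
  have sub_c: "f (A \<union> A' \<union> {c}) + f (A \<inter> A' \<union> {c}) \<le> f (A \<union> {c}) + f (A' \<union> {c})"
  proof -
    have "(A \<union> {c}) \<union> (A' \<union> {c}) = A \<union> A' \<union> {c}" "(A \<union> {c}) \<inter> (A' \<union> {c}) = A \<inter> A' \<union> {c}"
      by auto
    then show ?thesis
      using polymatroid_submodular[OF f, of "A \<union> {c}" "A' \<union> {c}"] AM by auto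
  qed
  have mix1: "f (A \<union> A' \<union> {c}) + f (A \<inter> A') \<le> f A + f (A' \<union> {c})"
  proof -
    have "A \<union> (A' \<union> {c}) = A \<union> A' \<union> {c}" "A \<inter> (A' \<union> {c}) = A \<inter> A'"
      using AM c by auto
    then show ?thesis
      using polymatroid_submodular[OF f, of A "A' \<union> {c}"] AM by auto
  qed
  have mix2: "f (A \<union> A' \<union> {c}) + f (A \<inter> A') \<le> f (A \<union> {c}) + f A'"
  proof -
    have "(A \<union> {c}) \<union> A' = A \<union> A' \<union> {c}" "(A \<union> {c}) \<inter> A' = A \<inter> A'"
      using AM c by auto
    then show ?thesis
      using polymatroid_submodular[OF f, of "A \<union> {c}" A'] AM by auto
  qed
  have "g (B \<inter> B') \<le> g B" "g (B \<inter> B') \<le> g B'"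
    by (rule polymatroid_mono[OF g], blast, use BP in blast)+
  moreover
  \<comment> \<open>\<open>u\<close> and \<open>v\<close> are the values at the union and the
    intersection. A minimum is at most either argument, so the choice can be adapted to each case:
    two sums are compared with two sums, two caps with two caps, and in the mixed cases
    \<open>u\<close> is bounded by its cap and \<open>v\<close> by its sum.\<close>
  define u v where "u = min (f (A \<union> A') + g (B \<union> B')) (f (A \<union> A' \<union> {c}))"
    and "v = min (f (A \<inter> A') + g (B \<inter> B')) (f (A \<inter> A' \<union> {c}))"
  have "u \<le> f (A \<union> A') + g (B \<union> B')" "u \<le> f (A \<union> A' \<union> {c})"
    "v \<le> f (A \<inter> A') + g (B \<inter> B')" "v \<le> f (A \<inter> A' \<union> {c})"
    by (simp_all add: u_def v_def)
  ultimately have "u + v \<le> (f A + g B) + (f A' + g B')" "u + v \<le> (f A + g B) + f (A' \<union> {c})"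
    "u + v \<le> f (A \<union> {c}) + (f A' + g B')" "u + v \<le> f (A \<union> {c}) + f (A' \<union> {c})"
    using sub_f sub_g sub_c mix1 mix2 by linarith+
  \<comment> \<open>The four bounds exhaust the ways in which the two minima on the right can be
    attained.\<close>
  then have "u + v \<le> min (f A + g B) (f (A \<union> {c})) + min (f A' + g B') (f (A' \<union> {c}))"
    by (auto simp: min_def)
  then show "amalgam f g M P c (X \<union> Y) + amalgam f g M P c (X \<inter> Y)
      \<le> amalgam f g M P c X + amalgam f g M P c Y"
    unfolding amalgam_def un int u_def v_def A_def B_def A'_def B'_def .
qed

theorem theorem14:
  fixes M P :: "'a set" and c :: 'a and f g :: "'a set \<Rightarrow> real"
  assumes "finite M" and "finite P" and "M \<inter> P = {}" and "c \<notin> M \<union> P"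
    and "polymatroid f (M \<union> {c})" and "polymatroid g P"
    and "f {c} = g P"
  shows "\<exists>r. polymatroid r (M \<union> P) \<and>
           (\<forall>A B. A \<subseteq> M \<and> B \<subseteq> P \<longrightarrow>
              r A = f A \<and> r B = g B \<and> r (A \<union> P) = f (A \<union> {c}))"
proof (rule exI[of _ "amalgam f g M P c"], intro conjI allI impI)
  show "polymatroid (amalgam f g M P c) (M \<union> P)"
    using assms by (intro polymatroid_amalgam) auto
next
  note f = assms(5) and g = assms(6)
  fix A B assume "A \<subseteq> M \<and> B \<subseteq> P"
  then have A: "A \<subseteq> M" and B: "B \<subseteq> P" by auto
  have traces: "A \<inter> M = A" "A \<inter> P = {}" "B \<inter> M = {}" "B \<inter> P = B"
      "(A \<union> P) \<inter> M = A" "(A \<union> P) \<inter> P = P"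
    using A B assms(3) by auto
  \<comment> \<open>Without elements of \<open>P\<close> the sum is \<open>f A\<close>, which must
    not exceed the cap.\<close>
  have "f A \<le> f (A \<union> {c})"
    by (rule polymatroid_mono[OF f]) (use A in auto)
  then show "amalgam f g M P c A = f A"
    by (simp add: amalgam_def traces polymatroid_empty[OF g])
  \<comment> \<open>Without elements of \<open>M\<close> the cap is \<open>f {c} = g P\<close>,
    which dominates \<open>g B\<close> by monotonicity.\<close>
  have "g B \<le> f {c}"
    using polymatroid_mono[OF g B] assms(7) by simp
  then show "amalgam f g M P c B = g B"
    by (simp add: amalgam_def traces polymatroid_empty[OF f])
  \<comment> \<open>Now the cap has to be the smaller argument. Since \<open>g P = f {c}\<close>,
    this is subadditivity of \<open>f\<close> on the disjoint sets \<open>A\<close> and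
    \<open>{c}\<close>.\<close>
  have "A \<inter> {c} = {}"
    using A assms(4) by auto
  then have "f (A \<union> {c}) \<le> f A + f {c}"
    using polymatroid_submodular[OF f, of A "{c}"] A polymatroid_empty[OF f] by auto
  then show "amalgam f g M P c (A \<union> P) = f (A \<union> {c})"
    unfolding amalgam_def traces using assms(7) by simp
qed

end
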